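(* For every metric space $X$, $$\dim_t X\leq \dim_{tH} X\leq \dim_H X.$$
   Context: $\dim_H$ denotes Hausdorff dimension, with the convention $\dim_H\emptyset=-1$. $\dim_t$ denotes the (small inductive) topological dimension: $\dim_t\emptyset=-1$ and, for non-empty $X$, inductively $\dim_t X=\inf\{d: X \text{ has a basis } \mathcal U \text{ with } \dim_t\partial U\le d-1 \text{ for every } U\in\mathcal U\}$. The topological Hausdorff dimension is defined by $\dim_{tH}\emptyset=-1$ and, for a non-empty metric space $X$, $\dim_{tH}X=\inf\{d: X \text{ has a basis } \mathcal U \text{ of open sets such that } \dim_H\partial U\le d-1 \text{ for every } U\in\mathcal U\}$. All these can take the value $\infty$; with the convention $\infty-1=\infty$, the value $d=\infty$ belongs to the sets of $d$ displayed above. *)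

theory Defs
  imports "HOL-Analysis.Analysis"
begin

definition basis_of_topology :: "'a topology \<Rightarrow> 'a set set \<Rightarrow> bool" where
  "basis_of_topology T \<U> \<longleftrightarrow> openin T = arbitrary union_of (\<lambda>U. U \<in> \<U>)"

text \<open>
  The library relation \<open>T dim_le n\<close> is ``the small inductive dimension of \<open>T\<close> is at most \<open>n\<close>'',
  for integers \<open>n \<ge> -1\<close>. The dimension itself is the least such \<open>n\<close>, and \<open>\<infinity>\<close> if there is none.
  The lemmas \<open>small_inductive_dim_empty\<close> and \<open>small_inductive_dim_rec\<close> below show that it satisfies
  the usual recursive characterization by bases, with the infimum taken over all extended reals.
\<close>

definition small_inductive_dim :: "'a topology \<Rightarrow> ereal" where
  "small_inductive_dim T = Inf {ereal (real_of_int n) | n. T dim_le n}"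

text \<open>
  The library's \<^const>\<open>diameter\<close> is real-valued and hence useless on unbounded sets; it is also
  restricted to the metric of a type class. The empty set has diameter \<open>0\<close> here.
\<close>

definition ediam :: "'a metric \<Rightarrow> 'a set \<Rightarrow> ennreal" where
  "ediam m E = (SUP x\<in>E. SUP y\<in>E. ennreal (mdist m x y))"

text \<open>
  \<open>(diam E)\<^sup>s\<close> for a set of finite diameter. Since \<open>0 powr 0 = 0\<close> in HOL, the conventions
  \<open>(diam E)\<^sup>0 = 1\<close> for nonempty \<open>E\<close> and \<open>(diam \<emptyset>)\<^sup>s = 0\<close>, which make the zero-dimensional measure
  the counting measure, are written out.
\<close>

definition diam_power :: "'a metric \<Rightarrow> real \<Rightarrow> 'a set \<Rightarrow> ennreal" where
  "diam_power m s E =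
     (if E = {} then 0 else if s = 0 then 1 else ennreal (enn2real (ediam m E) powr s))"

definition hausdorff_premeasure :: "'a metric \<Rightarrow> real \<Rightarrow> real \<Rightarrow> 'a set \<Rightarrow> ennreal" where
  "hausdorff_premeasure m s \<delta> A =
     Inf {(\<Sum>i. diam_power m s (E i)) | E :: nat \<Rightarrow> 'a set.
            A \<subseteq> (\<Union>i. E i) \<and> (\<forall>i. E i \<subseteq> mspace m \<and> ediam m (E i) \<le> ennreal \<delta>)}"

text \<open>
  The premeasures increase as \<open>\<delta>\<close> decreases to \<open>0\<close>, so their limit is a supremum.
\<close>

definition hausdorff_measure :: "'a metric \<Rightarrow> real \<Rightarrow> 'a set \<Rightarrow> ennreal" where
  "hausdorff_measure m s A = (SUP \<delta>\<in>{0<..}. hausdorff_premeasure m s \<delta> A)"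

definition hausdorff_dim :: "'a metric \<Rightarrow> ereal" where
  "hausdorff_dim m =
     (if mspace m = {} then -1
      else Inf {ereal s | s. 0 \<le> s \<and> hausdorff_measure m s (mspace m) = 0})"

text \<open>
  The boundary of \<open>U\<close> is taken in the space \<open>m\<close> and regarded as a metric space in its own right.
  In \<^typ>\<open>ereal\<close>, \<open>\<infinity> - 1 = \<infinity>\<close>, so \<open>d = \<infinity>\<close> is always admissible.
\<close>

definition topological_hausdorff_dim :: "'a metric \<Rightarrow> ereal" where
  "topological_hausdorff_dim m =
     (if mspace m = {} then -1
      else Inf {d :: ereal. \<exists>\<U>. basis_of_topology (mtopology_of m) \<U> \<and>
             (\<forall>U\<in>\<U>. hausdorff_dim (submetric m (mtopology_of m frontier_of U)) \<le> d - 1)})"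

lemma basis_of_topology_iff:
  "basis_of_topology T \<U> \<longleftrightarrow>
     (\<forall>U\<in>\<U>. openin T U) \<and> (\<forall>V a. openin T V \<and> a \<in> V \<longrightarrow> (\<exists>U\<in>\<U>. a \<in> U \<and> U \<subseteq> V))"
  unfolding basis_of_topology_def by (subst openin_topology_base_unique) blast

lemma small_inductive_dim_cases:
  obtains "small_inductive_dim T = \<infinity>" "\<And>n. \<not> T dim_le n"
  | k where "small_inductive_dim T = ereal (real_of_int k)" "-1 \<le> k"
      "\<And>n. T dim_le n \<longleftrightarrow> k \<le> n"
proof (cases "\<exists>n. T dim_le n")
  case False
  then have "{ereal (real_of_int n) | n. T dim_le n} = {}"
    by blast
  then show ?thesis
    using that(1) False by (simp add: small_inductive_dim_def top_ereal_def)
next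
  case True
  then obtain n0 where n0: "T dim_le n0"
    by blast
  define j where "j = (LEAST j::nat. T dim_le (int j - 1))"
  have "T dim_le (int (nat (n0 + 1)) - 1)"
    using n0 dimension_le_bound[OF n0] by simp
  then have j: "T dim_le (int j - 1)"
    unfolding j_def by (rule LeastI)
  have least: "int j - 1 \<le> n" if "T dim_le n" for n
  proof -
    have b: "-1 \<le> n"
      using that by (rule dimension_le_bound)
    then have "T dim_le (int (nat (n + 1)) - 1)"
      using that by simp
    then have "j \<le> nat (n + 1)"
      unfolding j_def by (rule Least_le)
    then show ?thesis
      using b by linarith
  qed
  have "small_inductive_dim T = ereal (real_of_int (int j - 1))"
    unfolding small_inductive_dim_def
  proof (rule antisym)
    show "Inf {ereal (real_of_int n) | n. T dim_le n} \<le> ereal (real_of_int (int j - 1))"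
      using j by (intro Inf_lower) blast
    show "ereal (real_of_int (int j - 1)) \<le> Inf {ereal (real_of_int n) | n. T dim_le n}"
    proof (rule Inf_greatest)
      fix x assume "x \<in> {ereal (real_of_int n) | n. T dim_le n}"
      then obtain n where "x = ereal (real_of_int n)" "T dim_le n"
        by blast
      then show "ereal (real_of_int (int j - 1)) \<le> x"
        using least[of n] by (simp only: ereal_less_eq of_int_le_iff)
    qed
  qed
  moreover have "T dim_le n \<longleftrightarrow> int j - 1 \<le> n" for n
    using least dimension_le_mono[OF j] by blast
  ultimately show ?thesis
    using that(2)[of "int j - 1"] by simp
qed

lemma small_inductive_dim_empty: "small_inductive_dim trivial_topology = -1"
proof (cases "trivial_topology :: 'a topology" rule: small_inductive_dim_cases)
  case 1
  have "(trivial_topology :: 'a topology) dim_le -1"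
    by simp
  with 1 show ?thesis
    by blast
next
  case (2 k)
  have "k \<le> -1"
    using 2(3)[of "-1"] by simp
  with 2(2) have "k = -1"
    by simp
  then show ?thesis
    using 2(1) by (simp add: one_ereal_def)
qed

lemma small_inductive_dim_rec:
  assumes "topspace T \<noteq> {}"
  shows "small_inductive_dim T =
    Inf {d :: ereal. \<exists>\<U>. basis_of_topology T \<U> \<and>
           (\<forall>U\<in>\<U>. small_inductive_dim (subtopology T (T frontier_of U)) \<le> d - 1)}"
    (is "_ = Inf ?D")
proof (rule antisym)
  show "small_inductive_dim T \<le> Inf ?D"
  proof (rule Inf_greatest)
    fix d assume "d \<in> ?D"
    then obtain \<U> where basis: "basis_of_topology T \<U>"
      and fr: "\<And>U. U \<in> \<U> \<Longrightarrow> small_inductive_dim (subtopology T (T frontier_of U)) \<le> d - 1"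
      by blast
    obtain a where a: "a \<in> topspace T"
      using assms by blast
    then obtain U0 where U0: "U0 \<in> \<U>"
      using basis unfolding basis_of_topology_iff by (meson openin_topspace)
    have ge: "-1 \<le> small_inductive_dim S" for S :: "'a topology"
    proof (cases S rule: small_inductive_dim_cases)
      case (2 k)
      then have "ereal (-1) \<le> small_inductive_dim S"
        by simp
      then show ?thesis
        by (simp add: one_ereal_def)
    qed simp
    have d1: "-1 \<le> d - 1"
      using order_trans[OF ge fr[OF U0]] .
    show "small_inductive_dim T \<le> d"
    proof (cases d)
      case (real r)
      have r: "0 \<le> r"
        using d1 real by (simp add: one_ereal_def)
      have fl: "subtopology T (T frontier_of U) dim_le (\<lfloor>r\<rfloor> - 1)" if "U \<in> \<U>" for U
      proof (cases "subtopology T (T frontier_of U)" rule: small_inductive_dim_cases)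
        case 1
        then show ?thesis
          using fr[OF that] real by (simp add: one_ereal_def)
      next
        case (2 k)
        then have "real_of_int k \<le> r - 1"
          using fr[OF that] real by (simp add: one_ereal_def)
        then have "k \<le> \<lfloor>r\<rfloor> - 1"
          by linarith
        then show ?thesis
          using 2 by blast
      qed
      have dim: "T dim_le \<lfloor>r\<rfloor>"
      proof (rule dimension_le.intros)
        show "-1 \<le> \<lfloor>r\<rfloor>"
          using r by linarith
        fix V a assume "openin T V" "a \<in> V"
        then obtain U where "U \<in> \<U>" "a \<in> U" "U \<subseteq> V"
          using basis unfolding basis_of_topology_iff by blast
        then show "\<exists>U. a \<in> U \<and> U \<subseteq> V \<and> openin T U \<and>
            subtopology T (T frontier_of U) dim_le (\<lfloor>r\<rfloor> - 1)"
          using fl basis unfolding basis_of_topology_iff by blast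
      qed
      then have "small_inductive_dim T \<le> ereal (real_of_int \<lfloor>r\<rfloor>)"
        unfolding small_inductive_dim_def by (intro Inf_lower) blast
      also have "\<dots> \<le> d"
        using real by simp
      finally show ?thesis .
    qed (use d1 in \<open>auto simp: one_ereal_def\<close>)
  qed
next
  show "Inf ?D \<le> small_inductive_dim T"
  proof (cases T rule: small_inductive_dim_cases)
    case (2 k)
    define \<U> where
      "\<U> = {U. openin T U \<and> subtopology T (T frontier_of U) dim_le (k - 1)}"
    have "T dim_le k"
      using 2 by blast
    then have "\<exists>U. a \<in> U \<and> U \<subseteq> V \<and> openin T U \<and> subtopology T (T frontier_of U) dim_le (k - 1)"
      if "openin T V" "a \<in> V" for V a
      using that by (subst (asm) dimension_le.simps) blast
    then have "basis_of_topology T \<U>"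
      unfolding basis_of_topology_iff \<U>_def by blast
    moreover have "small_inductive_dim (subtopology T (T frontier_of U))
        \<le> small_inductive_dim T - 1" if "U \<in> \<U>" for U
    proof -
      have "small_inductive_dim (subtopology T (T frontier_of U)) \<le> ereal (real_of_int (k - 1))"
        unfolding small_inductive_dim_def using that by (intro Inf_lower) (unfold \<U>_def, blast)
      then show ?thesis
        using 2(1) by (simp add: one_ereal_def)
    qed
    ultimately show ?thesis
      by (intro Inf_lower) blast
  qed simp
qed

end

theory Submission
  imports Defs
begin

text \<open>
  If \<open>H\<^sup>s(X) = 0\<close> and \<open>t = max s 1\<close>, then almost every sphere about a given point is
  \<open>H\<^bsup>t-1\<^esup>\<close>-null: the distance to the point is 1-Lipschitz, so a cover \<open>E\<^sub>i\<close> of \<open>X\<close> yields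
  intervals of length \<open>2 diam E\<^sub>i\<close> containing all radii whose spheres meet \<open>E\<^sub>i\<close>, and integrating the
  sum of the \<open>(diam E\<^sub>i)\<^bsup>t-1\<^esup>\<close> over the radii gives at most twice the sum of the \<open>(diam E\<^sub>i)\<^sup>t\<close>.
  Balls with null spheres form a basis, which gives the second inequality. By induction on the
  dimension, the second inequality implies Szpilrajn's inequality between the small inductive and
  the Hausdorff dimension; applied to the boundaries of basic sets, it gives the first one.
\<close>

section \<open>Diameters and their powers\<close>

lemma ediam_mono: "A \<subseteq> B \<Longrightarrow> ediam m A \<le> ediam m B"
  unfolding ediam_def by (intro SUP_subset_mono order_refl)

lemma ediam_submetric [simp]: "ediam (submetric m S) E = ediam m E"
  by (simp add: ediam_def)

lemma diam_power_submetric [simp]: "diam_power (submetric m S) s E = diam_power m s E"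
  by (simp add: diam_power_def)

lemma diam_power_empty [simp]: "diam_power m s {} = 0"
  by (simp add: diam_power_def)

lemma mdist_le_ediam:
  assumes "x \<in> E" "y \<in> E" "ediam m E < top"
  shows "mdist m x y \<le> enn2real (ediam m E)"
proof -
  have "ennreal (mdist m x y) \<le> ediam m E"
    unfolding ediam_def using assms by (meson SUP_upper2 order_refl)
  then show ?thesis
    using assms(3) by (metis enn2real_ennreal enn2real_mono mdist_nonneg)
qed

text \<open>Finiteness of \<open>ediam m B\<close> matters: \<open>enn2real\<close> sends
  \<open>top\<close> to 0, so for \<open>s > 0\<close> a set of infinite diameter would get power
  0.\<close>

lemma diam_power_mono:
  assumes "A \<subseteq> B" "0 \<le> s" "ediam m B < top"
  shows "diam_power m s A \<le> diam_power m s B"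
  using assms by (auto simp: diam_power_def intro!: ennreal_leI powr_mono2 enn2real_mono ediam_mono)

lemma diam_power_antimono_exponent:
  assumes "0 \<le> s" "s \<le> t" "ediam m E \<le> 1"
  shows "diam_power m t E \<le> diam_power m s E"
proof -
  have "enn2real (ediam m E) \<le> 1"
    using enn2real_mono[OF assms(3)] by simp
  then show ?thesis
    using assms powr_mono'[of s t "enn2real (ediam m E)"]
    by (auto simp: diam_power_def intro!: ennreal_leI powr_le1)
qed

lemma diam_power_mult_diam:
  assumes "1 \<le> t"
  shows "diam_power m (t - 1) E * ennreal (enn2real (ediam m E)) \<le> diam_power m t E"
proof -
  have "x powr (t - 1) * x = x powr t" if "0 \<le> x" for x :: real
    using that powr_mult_base[of x "t - 1"] by (simp add: mult.commute)
  then show ?thesis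
    using assms by (auto simp: diam_power_def simp flip: ennreal_mult)
qed

section \<open>Null sets of Hausdorff measures, and spheres about a point\<close>

lemma hausdorff_measure_eq_0D:
  assumes "hausdorff_measure m s A = 0" "0 < \<delta>" "0 < c"
  obtains E :: "nat \<Rightarrow> 'a set" where "A \<subseteq> (\<Union>i. E i)" "\<And>i. E i \<subseteq> mspace m"
    "\<And>i. ediam m (E i) \<le> ennreal \<delta>" "(\<Sum>i. diam_power m s (E i)) < c"
proof -
  have "hausdorff_premeasure m s \<delta> A \<le> hausdorff_measure m s A"
    unfolding hausdorff_measure_def using assms(2) by (intro SUP_upper) simp
  then have "hausdorff_premeasure m s \<delta> A < c"
    using assms by simp
  then show ?thesis
    unfolding hausdorff_premeasure_def Inf_less_iff using that by blast
qed

text \<open>The covers may stick out of \<open>F\<close>; their traces on \<open>F\<close> are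
  covers inside the subspace. For each \<open>d\<close>, the mesh is eventually below
  \<open>d\<close>, so \<open>g n\<close> bounds the premeasure at scale \<open>d\<close> for all
  large \<open>n\<close>, and \<open>g\<close> tends to 0.\<close>

lemma hausdorff_measure_submetric_eq_0I:
  assumes "0 \<le> s" "F \<subseteq> mspace m" "g \<longlonglongrightarrow> 0" "\<delta> \<longlonglongrightarrow> 0"
    and E: "\<And>n. F \<subseteq> (\<Union>i. E n i)" "\<And>n i. ediam m (E n i) \<le> ennreal (\<delta> n)"
    and g: "\<And>n. (\<Sum>i. diam_power m s (E n i \<inter> F)) \<le> g n"
  shows "hausdorff_measure (submetric m F) s F = 0"
proof -
  have "hausdorff_premeasure (submetric m F) s d F \<le> 0" if "0 < d" for d
  proof (rule tendsto_lowerbound[OF assms(3)])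
    show "\<forall>\<^sub>F n in sequentially. hausdorff_premeasure (submetric m F) s d F \<le> g n"
      using order_tendstoD(2)[OF assms(4) that]
    proof eventually_elim
      case (elim n)
      have "ediam m (E n i \<inter> F) \<le> ennreal d" for i
        using ediam_mono[of "E n i \<inter> F" "E n i" m] E(2)[of n i] ennreal_leI[of "\<delta> n" d] elim
        by (meson Int_lower1 less_imp_le order_trans)
      moreover have "F \<subseteq> (\<Union>i. E n i \<inter> F)"
        using E(1)[of n] by blast
      ultimately have "hausdorff_premeasure (submetric m F) s d F
          \<le> (\<Sum>i. diam_power m s (E n i \<inter> F))"
        unfolding hausdorff_premeasure_def using assms(2)
        by (intro Inf_lower CollectI exI[of _ "\<lambda>i. E n i \<inter> F"]) auto
      then show ?case
        using g order_trans by blast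
    qed
  qed simp
  then show ?thesis
    unfolding hausdorff_measure_def by (intro antisym SUP_least) auto
qed

text \<open>The exceptional radii are chosen before \<open>F\<close>: later \<open>F\<close> is the
  frontier of a ball, which may be a proper subset of the sphere.\<close>

lemma AE_hausdorff_measure_sphere:
  assumes "0 \<le> s" "s \<le> t" "1 \<le> t" and null: "hausdorff_measure m s (mspace m) = 0"
    and x: "x \<in> mspace m"
  shows "AE r in lborel. \<forall>F \<subseteq> {y \<in> mspace m. mdist m x y = r}.
           hausdorff_measure (submetric m F) (t - 1) F = 0"
proof -
  \<comment> \<open>The costs are geometric so that the integrals below have a finite sum over
    \<open>n\<close>.\<close>
  have "\<exists>E :: nat \<Rightarrow> 'a set. mspace m \<subseteq> (\<Union>i. E i) \<and> (\<forall>i. E i \<subseteq> mspace m) \<and>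
      (\<forall>i. ediam m (E i) \<le> ennreal (inverse (real (Suc n)))) \<and>
      (\<Sum>i. diam_power m s (E i)) < ennreal ((1/2) ^ n)" for n
    by (rule hausdorff_measure_eq_0D[OF null, of "inverse (real (Suc n))" "ennreal ((1/2) ^ n)"])
      auto
  then obtain E :: "nat \<Rightarrow> nat \<Rightarrow> 'a set" where E:
    "\<And>n. mspace m \<subseteq> (\<Union>i. E n i)" "\<And>n i. E n i \<subseteq> mspace m"
    "\<And>n i. ediam m (E n i) \<le> ennreal (inverse (real (Suc n)))"
    "\<And>n. (\<Sum>i. diam_power m s (E n i)) < ennreal ((1/2) ^ n)"
    by metis
  \<comment> \<open>Diameters at most 1 allow passing from exponent \<open>t\<close> to the smaller
    \<open>s\<close>.\<close>
  have le1: "ediam m (E n i) \<le> 1" for n i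
    using E(3)[of n i] ennreal_leI[of "inverse (real (Suc n))" 1]
    by (simp add: inverse_le_1_iff order_trans)
  have fin: "ediam m (E n i) < top" for n i
    using le1[of n i] by (simp add: order_le_less_trans)
  define D where "D n i = enn2real (ediam m (E n i))" for n i
  \<comment> \<open>For empty \<open>E n i\<close> the chosen centre is arbitrary; this is harmless,
    as the interval then has weight 0 in \<open>g\<close>.\<close>
  define c where "c n i = mdist m x (SOME p. p \<in> E n i)" for n i
  have near: "mdist m x y \<in> {c n i - D n i .. c n i + D n i}" if "y \<in> E n i" for n i y
  proof -
    define p where "p = (SOME p. p \<in> E n i)"
    have p: "p \<in> E n i"
      unfolding p_def using that by (rule someI)
    have "mdist m p y \<le> D n i"
      unfolding D_def by (rule mdist_le_ediam[OF p that fin])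
    moreover have "mdist m x y \<le> mdist m x p + mdist m p y"
        "mdist m x p \<le> mdist m x y + mdist m y p"
      using x p that E(2) by (meson mdist_triangle subsetD)+
    ultimately show ?thesis
      unfolding c_def p_def[symmetric] by (simp add: mdist_commute)
  qed
  \<comment> \<open>By \<open>near\<close>, every \<open>E n i\<close> that meets the sphere of
    radius \<open>r\<close> is counted in \<open>g n r\<close>.\<close>
  define g where
    "g n r = (\<Sum>i. diam_power m (t - 1) (E n i) * indicator {c n i - D n i .. c n i + D n i} r)"
    for n r
  have meas [measurable]: "g n \<in> borel_measurable lborel" for n
    unfolding g_def by measurable
  have int_g: "(\<integral>\<^sup>+ r. g n r \<partial>lborel) \<le> 2 * ennreal ((1/2) ^ n)" for n
  proof -
    have "(\<integral>\<^sup>+ r. g n r \<partial>lborel) = (\<Sum>i. diam_power m (t - 1) (E n i) * ennreal (2 * D n i))"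
      unfolding g_def by (subst nn_integral_suminf) (auto simp: nn_integral_cmult_indicator D_def)
    also have "\<dots> \<le> (\<Sum>i. 2 * diam_power m s (E n i))"
    proof (intro suminf_le summableI)
      fix i
      have "diam_power m (t - 1) (E n i) * ennreal (D n i) \<le> diam_power m s (E n i)"
        unfolding D_def using diam_power_mult_diam[OF assms(3)]
          diam_power_antimono_exponent[OF assms(1,2) le1] order_trans by blast
      then show "diam_power m (t - 1) (E n i) * ennreal (2 * D n i) \<le> 2 * diam_power m s (E n i)"
        by (simp add: ennreal_mult' mult.left_commute mult_left_mono)
    qed
    also have "\<dots> = 2 * (\<Sum>i. diam_power m s (E n i))"
      by simp
    also have "\<dots> \<le> 2 * ennreal ((1/2) ^ n)"
      using E(4)[of n] by (intro mult_left_mono) auto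
    finally show ?thesis .
  qed
  \<comment> \<open>A Borel-Cantelli argument: the sum over \<open>n\<close> has finite integral, so
    for almost every \<open>r\<close> it converges and its terms tend to 0.\<close>
  have "(\<integral>\<^sup>+ r. (\<Sum>n. g n r) \<partial>lborel) = (\<Sum>n. \<integral>\<^sup>+ r. g n r \<partial>lborel)"
    by (rule nn_integral_suminf) measurable
  also have "\<dots> \<le> (\<Sum>n. 2 * ennreal ((1/2) ^ n))"
    using int_g by (intro suminf_le summableI)
  also have "\<dots> = 2 * ennreal (\<Sum>n. (1/2) ^ n)"
    by (simp add: suminf_ennreal2 summable_geometric)
  also have "\<dots> < \<infinity>"
    by (simp add: ennreal_mult_less_top)
  finally have "AE r in lborel. (\<Sum>n. g n r) \<noteq> \<infinity>"
    by (intro nn_integral_PInf_AE) auto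
  then show ?thesis
  proof eventually_elim
    case (elim r)
    have lim: "(\<lambda>n. g n r) \<longlonglongrightarrow> 0"
    proof -
      have "\<And>n. g n r \<noteq> top"
        using elim by (metis ennreal_suminf_lessD infinity_ennreal_def top.not_eq_extremum)
      then have eq: "g n r = ennreal (enn2real (g n r))" for n
        by (simp add: less_top)
      then have "summable (\<lambda>n. enn2real (g n r))"
        using elim by (intro summable_suminf_not_top) auto
      then have "(\<lambda>n. ennreal (enn2real (g n r))) \<longlonglongrightarrow> ennreal 0"
        by (intro tendsto_ennrealI summable_LIMSEQ_zero)
      then show ?thesis
        using eq by simp
    qed
    show ?case
    proof (intro allI impI)
      fix F assume F: "F \<subseteq> {y \<in> mspace m. mdist m x y = r}"
      show "hausdorff_measure (submetric m F) (t - 1) F = 0"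
      proof (rule hausdorff_measure_submetric_eq_0I[OF _ _ lim LIMSEQ_inverse_real_of_nat])
        show "F \<subseteq> (\<Union>i. E n i)" for n
          using E(1)[of n] F by blast
        show "(\<Sum>i. diam_power m (t - 1) (E n i \<inter> F)) \<le> g n r" for n
          unfolding g_def
        proof (intro suminf_le summableI)
          fix i
          show "diam_power m (t - 1) (E n i \<inter> F)
              \<le> diam_power m (t - 1) (E n i) * indicator {c n i - D n i .. c n i + D n i} r"
          \<comment> \<open>Sets missing \<open>F\<close> must cost nothing even for
            \<open>t = 1\<close>, which is why the empty set has power 0 at exponent 0.\<close>
          proof (cases "E n i \<inter> F = {}")
            case False
            then have "r \<in> {c n i - D n i .. c n i + D n i}"
              using near F by blast
            then show ?thesis
              using diam_power_mono[of "E n i \<inter> F" "E n i" "t - 1" m] fin assms(3) by simp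
          qed simp
        qed
      qed (use F E(3) assms(3) in auto)
    qed
  qed
qed

text \<open>At exponent 0 each nonempty member of a cover costs 1. Hence a null set at exponent 0 is
  empty.\<close>

lemma hausdorff_measure_0_neq_0:
  assumes "A \<noteq> {}"
  shows "hausdorff_measure m 0 A \<noteq> 0"
proof
  assume "hausdorff_measure m 0 A = 0"
  then obtain E :: "nat \<Rightarrow> _" where E: "A \<subseteq> (\<Union>i. E i)" "(\<Sum>i. diam_power m 0 (E i)) < 1"
    by (rule hausdorff_measure_eq_0D[of _ _ _ 1 1]) auto
  then obtain i where "E i \<noteq> {}"
    using assms by blast
  then have "1 \<le> sum (\<lambda>i. diam_power m 0 (E i)) {i}"
    by (simp add: diam_power_def)
  also have "\<dots> \<le> (\<Sum>i. diam_power m 0 (E i))"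
    by (rule sum_le_suminf) auto
  finally show False
    using E(2) by simp
qed

section \<open>Topological Hausdorff dimension against Hausdorff dimension\<close>

lemma hausdorff_dim_le:
  assumes "0 \<le> s" "hausdorff_measure m s (mspace m) = 0"
  shows "hausdorff_dim m \<le> ereal s"
proof (cases "mspace m = {}")
  case True
  have "- 1 \<le> ereal s"
    using assms(1) by (simp add: one_ereal_def)
  then show ?thesis
    using True by (simp add: hausdorff_dim_def)
next
  case False
  then show ?thesis
    using assms by (auto simp: hausdorff_dim_def intro!: Inf_lower)
qed

lemma hausdorff_dim_nonneg:
  assumes "mspace m \<noteq> {}"
  shows "0 \<le> hausdorff_dim m"
  using assms by (auto simp: hausdorff_dim_def intro!: Inf_greatest)

lemma frontier_of_mball_of_subset:
  "mtopology_of m frontier_of mball_of m x r \<subseteq> {y \<in> mspace m. mdist m x y = r}"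
proof -
  interpret Metric_space "mspace m" "mdist m"
    by (rule Metric_space_mspace_mdist)
  have "mtopology closure_of mball x r \<subseteq> mcball x r"
    by (intro closure_of_minimal mball_subset_mcball closedin_mcball)
  moreover have "mtopology interior_of mball x r = mball x r"
    by (simp add: interior_of_openin)
  ultimately show ?thesis
    by (auto simp: frontier_of_def mball_of_def mtopology_of_def)
qed

lemma topological_hausdorff_dim_le:
  assumes "0 \<le> s" and null: "hausdorff_measure m s (mspace m) = 0"
  shows "topological_hausdorff_dim m \<le> ereal s"
proof (cases "mspace m = {}")
  case True
  have "- 1 \<le> ereal s"
    using assms(1) by (simp add: one_ereal_def)
  then show ?thesis
    using True by (simp add: topological_hausdorff_dim_def)
next
  case False
  interpret Metric_space "mspace m" "mdist m"
    by (rule Metric_space_mspace_mdist)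
  \<comment> \<open>The maximum keeps \<open>t - 1\<close> nonnegative. If \<open>s\<close> is at
    most 1, then \<open>t = 1\<close> and the null subsets of spheres are empty, of dimension -1,
    which is at most \<open>s - 1\<close>.\<close>
  define t where "t = max s 1"
  have small: "hausdorff_dim (submetric m F) \<le> ereal s - 1"
    if "F \<subseteq> mspace m" "hausdorff_measure (submetric m F) (t - 1) F = 0" for F
  proof (cases "F = {}")
    case True
    then show ?thesis
      using assms(1) by (simp add: hausdorff_dim_def one_ereal_def)
  next
    case False
    then have "t \<noteq> 1"
      using that(2) hausdorff_measure_0_neq_0[OF False, of "submetric m F"] by auto
    then have "t = s" "1 \<le> s"
      by (auto simp: t_def)
    then show ?thesis
      using hausdorff_dim_le[of "s - 1" "submetric m F"] that
      by (simp add: one_ereal_def inf.absorb1)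
  qed
  define \<U> where "\<U> = {U. openin (mtopology_of m) U \<and>
    hausdorff_dim (submetric m (mtopology_of m frontier_of U)) \<le> ereal s - 1}"
  have "basis_of_topology (mtopology_of m) \<U>"
    unfolding basis_of_topology_iff
  proof (intro conjI allI impI)
    fix V a assume V: "openin (mtopology_of m) V \<and> a \<in> V"
    then obtain e where e: "0 < e" "mball a e \<subseteq> V" and a: "a \<in> mspace m"
      unfolding mtopology_of_def openin_mtopology by blast
    have "AE r in lborel. \<forall>F \<subseteq> {y \<in> mspace m. mdist m a y = r}.
           hausdorff_measure (submetric m F) (t - 1) F = 0"
      using assms a by (intro AE_hausdorff_measure_sphere) (auto simp: t_def)
    then obtain N where N: "N \<in> null_sets lborel"
      "\<And>r F. r \<notin> N \<Longrightarrow> F \<subseteq> {y \<in> mspace m. mdist m a y = r} \<Longrightarrow>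
         hausdorff_measure (submetric m F) (t - 1) F = 0"
      by (auto elim!: AE_E3)
    \<comment> \<open>An interval of positive length is not Lebesgue null, so some radius below
      \<open>e\<close> is good.\<close>
    have "\<not> {0<..<e} \<subseteq> N"
    proof
      assume "{0<..<e} \<subseteq> N"
      then have "emeasure lborel {0<..<e} \<le> emeasure lborel N"
        using N(1) by (intro emeasure_mono) auto
      then show False
        using N(1) e(1) by (simp add: null_setsD1)
    qed
    then obtain r where r: "0 < r" "r < e" "r \<notin> N"
      by (auto simp: subset_iff)
    have "hausdorff_dim (submetric m (mtopology_of m frontier_of mball_of m a r)) \<le> ereal s - 1"
      using frontier_of_mball_of_subset[of m a r] N(2)[OF r(3)] by (intro small) auto
    then have "mball a r \<in> \<U>"
      by (simp add: \<U>_def mball_of_def mtopology_of_def)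
    moreover have "a \<in> mball a r" "mball a r \<subseteq> V"
      using r a e mball_subset_concentric[of r e a] by auto
    ultimately show "\<exists>U\<in>\<U>. a \<in> U \<and> U \<subseteq> V"
      by blast
  qed (simp add: \<U>_def)
  then show ?thesis
    using False unfolding topological_hausdorff_dim_def
    by (auto simp: \<U>_def intro!: Inf_lower)
qed

lemma topological_hausdorff_dim_le_hausdorff_dim:
  "topological_hausdorff_dim m \<le> hausdorff_dim m"
proof (cases "mspace m = {}")
  case True
  then show ?thesis
    by (simp add: topological_hausdorff_dim_def hausdorff_dim_def)
next
  case False
  then show ?thesis
    unfolding hausdorff_dim_def
    by (auto intro!: Inf_greatest topological_hausdorff_dim_le)
qed

section \<open>Small inductive dimension against the other two\<close>

lemma dim_le_if_hausdorff_dim_less: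
  "hausdorff_dim m < ereal (real n) \<Longrightarrow> mtopology_of m dim_le (int n - 1)"
proof (induction n arbitrary: m)
  case 0
  then have "mspace m = {}"
    using hausdorff_dim_nonneg[of m] by (fastforce simp: zero_ereal_def not_less[symmetric])
  then show ?case
    by (simp flip: null_topspace_iff_trivial)
next
  case (Suc n)
  show ?case
  proof (cases "mspace m = {}")
    \<comment> \<open>The empty space is split off because its
      \<open>topological_hausdorff_dim\<close> is -1 by convention and yields no basis.\<close>
    case True
    then have "mtopology_of m dim_le -1"
      by (simp flip: null_topspace_iff_trivial)
    then show ?thesis
      by (rule dimension_le_mono) simp
  next
    case False
    have "topological_hausdorff_dim m < ereal (real (Suc n))"
      using topological_hausdorff_dim_le_hausdorff_dim Suc.prems by (rule le_less_trans)
    \<comment> \<open>The strict bound provides an admissible \<open>d\<close> below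
      \<open>Suc n\<close> without the infimum having to be attained. Frontiers then have Hausdorff
      dimension below \<open>n\<close>, again strictly, as the induction requires.\<close>
    then obtain d \<U> where d: "d < ereal (real (Suc n))"
      and \<U>: "basis_of_topology (mtopology_of m) \<U>"
      and fr: "\<And>U. U \<in> \<U> \<Longrightarrow>
        hausdorff_dim (submetric m (mtopology_of m frontier_of U)) \<le> d - 1"
      using False unfolding topological_hausdorff_dim_def by (auto simp: Inf_less_iff)
    have "d - 1 < ereal (real n)"
      using d by (cases d) (auto simp: one_ereal_def)
    then have "subtopology (mtopology_of m) (mtopology_of m frontier_of U) dim_le (int n - 1)"
      if "U \<in> \<U>" for U
      using Suc.IH[OF le_less_trans[OF fr[OF that]]] by (simp add: mtopology_of_submetric)
    then show ?thesis
      using \<U> unfolding basis_of_topology_iff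
      by (intro dimension_le.intros) (simp, simp, metis)
  qed
qed

lemma small_inductive_dim_le_hausdorff_dim:
  "small_inductive_dim (mtopology_of m) \<le> hausdorff_dim m"
proof (cases "mspace m = {}")
  case True
  then have "mtopology_of m = trivial_topology"
    by (simp flip: null_topspace_iff_trivial)
  then show ?thesis
    using True by (simp add: small_inductive_dim_empty hausdorff_dim_def)
next
  case False
  show ?thesis
  proof (cases "hausdorff_dim m")
    case (real h)
    \<comment> \<open>\<open>Suc n\<close> is the least natural number above \<open>h\<close>, so
      the integer bound obtained is \<open>n\<close>, the floor of \<open>h\<close>.\<close>
    define n where "n = nat \<lfloor>h\<rfloor>"
    have h: "0 \<le> h"
      using hausdorff_dim_nonneg[OF False] real by simp
    then have n: "h < real (Suc n)" "real n \<le> h"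
      unfolding n_def by linarith+
    then have "mtopology_of m dim_le (int (Suc n) - 1)"
      using real by (intro dim_le_if_hausdorff_dim_less) simp
    then have "small_inductive_dim (mtopology_of m) \<le> ereal (real_of_int (int (Suc n) - 1))"
      unfolding small_inductive_dim_def by (intro Inf_lower) blast
    also have "\<dots> \<le> hausdorff_dim m"
      using n real by simp
    finally show ?thesis .
  qed (use hausdorff_dim_nonneg[OF False] in auto)
qed

lemma small_inductive_dim_le_topological_hausdorff_dim:
  "small_inductive_dim (mtopology_of m) \<le> topological_hausdorff_dim m"
proof (cases "mspace m = {}")
  case True
  then have "mtopology_of m = trivial_topology"
    by (simp flip: null_topspace_iff_trivial)
  then show ?thesis
    using True by (simp add: small_inductive_dim_empty topological_hausdorff_dim_def)
next
  case False
  have le: "small_inductive_dim (subtopology (mtopology_of m) S) \<le> hausdorff_dim (submetric m S)"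
    for S
    using small_inductive_dim_le_hausdorff_dim[of "submetric m S"]
    by (simp add: mtopology_of_submetric)
  show ?thesis
    using False unfolding topological_hausdorff_dim_def
    \<comment> \<open>Both sides are infima over bases. By \<open>le\<close>, every \<open>d\<close>
      admissible on the right is admissible on the left with the same basis.\<close>
    by (subst small_inductive_dim_rec) (auto intro!: Inf_superset_mono intro: order_trans[OF le])
qed

theorem theorem4p4:
  fixes X :: "'a metric"
  shows "small_inductive_dim (mtopology_of X) \<le> topological_hausdorff_dim X \<and>
         topological_hausdorff_dim X \<le> hausdorff_dim X"
  using small_inductive_dim_le_topological_hausdorff_dim topological_hausdorff_dim_le_hausdorff_dim
  by blast

end
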